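(* Let $R$ be a commutative ring with nonzero identity, let $M$ be a cyclic $R$-module, and let $\{P_1,\ldots,P_n\}$ be a finite set of $n$ distinct minimal prime submodules of $M$. Then there exists a clique of size $n$ in $AG(M)$.
   Context: For a submodule $N\leq M$, $(N:M)=\{r\in R : rM\subseteq N\}$. The product of submodules $N,K\leq M$ is $NK:=(N:M)(K:M)M$. The annihilating-submodule graph $AG(M)$ is the undirected graph whose vertices are the nonzero submodules $N$ of $M$ (possibly $N=M$) for which there exists a nonzero proper submodule $K$ of $M$ with $NK=(0)$; two distinct vertices $N,K$ are adjacent if and only if $NK=(0)$. A graph has, by convention, a nonempty vertex set, so statements about $AG(M)$ presuppose that it has at least one vertex. A clique is a complete subgraph. A prime submodule of $M$ is a submodule $P\neq M$ such that whenever $re\in P$ with $r\in R$, $e\in M$, then $r\in (P:M)$ or $e\in P$. A minimal prime submodule is a prime submodule that is minimal with respect to inclusion among all prime submodules of $M$. *)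

theory Defs
  imports Main HOL.Modules
begin

text \<open>
  The ring \<open>R\<close> is a type of class \<open>comm_ring_1\<close> (so \<open>0 \<noteq> 1\<close>), and \<open>M\<close> is the whole carrier type
  of the library locale \<open>module\<close>.  The library's \<open>subspace\<close> and \<open>span\<close> are defined for arbitrary
  modules: \<open>subspace N\<close> says that \<open>N\<close> is a submodule, and \<open>span S\<close> is the submodule generated by \<open>S\<close>.
\<close>

text \<open>\<open>module.span (*)\<close> is the ideal generated by a set, \<open>R\<close> being a module over itself.\<close>

definition ideal_mult :: "'r::comm_ring_1 set \<Rightarrow> 'r set \<Rightarrow> 'r set" where
  "ideal_mult I J = module.span (*) {a * b | a b. a \<in> I \<and> b \<in> J}"

context module
begin

definition cyclic_module :: bool where
  "cyclic_module \<longleftrightarrow> (\<exists>x. span {x} = UNIV)"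

definition colon :: "'b set \<Rightarrow> 'a set" where
  "colon N = {r. \<forall>m. r *s m \<in> N}"

definition ideal_smult :: "'a set \<Rightarrow> 'b set" where
  "ideal_smult I = span {r *s m | r m. r \<in> I}"

text \<open>The product \<open>NK = (N : M)(K : M)M\<close>.\<close>

definition submodule_mult :: "'b set \<Rightarrow> 'b set \<Rightarrow> 'b set" where
  "submodule_mult N K = ideal_smult (ideal_mult (colon N) (colon K))"

definition prime_submodule :: "'b set \<Rightarrow> bool" where
  "prime_submodule P \<longleftrightarrow> subspace P \<and> P \<noteq> UNIV \<and>
     (\<forall>r e. r *s e \<in> P \<longrightarrow> r \<in> colon P \<or> e \<in> P)"

definition minimal_prime_submodule :: "'b set \<Rightarrow> bool" where
  "minimal_prime_submodule P \<longleftrightarrow> prime_submodule P \<and>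
     (\<forall>Q. prime_submodule Q \<and> Q \<subseteq> P \<longrightarrow> Q = P)"

text \<open>
  Only the witness \<open>K\<close> is required to be proper; \<open>N = UNIV\<close>, i.e. \<open>N = M\<close>, may be a vertex.
\<close>

definition AG_verts :: "'b set set" where
  "AG_verts = {N. subspace N \<and> N \<noteq> {0} \<and>
     (\<exists>K. subspace K \<and> K \<noteq> {0} \<and> K \<noteq> UNIV \<and> submodule_mult N K = {0})}"

definition AG_adj :: "'b set \<Rightarrow> 'b set \<Rightarrow> bool" where
  "AG_adj N K \<longleftrightarrow> N \<in> AG_verts \<and> K \<in> AG_verts \<and> N \<noteq> K \<and> submodule_mult N K = {0}"

definition AG_clique :: "'b set set \<Rightarrow> bool" where
  "AG_clique C \<longleftrightarrow> C \<subseteq> AG_verts \<and> (\<forall>N\<in>C. \<forall>K\<in>C. N \<noteq> K \<longrightarrow> AG_adj N K)"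

end

end

theory Submission imports Defs begin

text \<open>
  Write \<open>M = Rx\<close>. A minimal prime submodule \<open>P\<close> behaves like a minimal prime ideal over the annihilator
  of \<open>x\<close>: every \<open>a\<close> with \<open>ax \<in> P\<close> is nilpotent on \<open>x\<close> up to a multiplier outside \<open>P\<close>, that is,
  \<open>s a\<^sup>k x = 0\<close> for some \<open>s\<close> with \<open>sx \<notin> P\<close> (\<open>minimal_prime_submodule_annihilator\<close>). This is the
  module form of the fact that the localization at a minimal prime has a nil maximal ideal, and it
  follows from Krull's lemma on submodules maximal among those avoiding a multiplicative set
  (\<open>prime_submodule_avoiding\<close>).

  Let \<open>\<P>\<close> be the given set, with at least two members. Minimality makes its members pairwise
  incomparable, so each \<open>P \<in> \<P>\<close> has an \<open>a\<^sub>P\<close> with \<open>a\<^sub>P x\<close> in every other member but not in \<open>P\<close>. For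
  \<open>P \<noteq> Q\<close>, the element \<open>a\<^sub>P a\<^sub>Q x\<close> lies in \<open>P\<close>, so \<open>s\<^sub>P\<^sub>Q (a\<^sub>P a\<^sub>Q)\<^sup>k x = 0\<close> with \<open>s\<^sub>P\<^sub>Q x \<notin> P\<close>. With one
  exponent \<open>k\<close> for all pairs, put \<open>b\<^sub>P = a\<^sub>P\<^sup>k \<Prod>\<^sub>Q s\<^sub>P\<^sub>Q\<close>. Then \<open>b\<^sub>P b\<^sub>Q x = 0\<close>, since the multiplier inside
  \<open>b\<^sub>P\<close> alone already kills \<open>(a\<^sub>P a\<^sub>Q)\<^sup>k x\<close>, and \<open>b\<^sub>P x\<close> is still in every member of \<open>\<P>\<close> except \<open>P\<close>.
  The submodules \<open>R b\<^sub>P x\<close> therefore form the clique.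

  The argument pairs each vertex with another one as its annihilating witness, so it needs two
  primes. For a single prime the clique is any vertex, and this is where the nonemptiness of the
  graph enters: over a simple module the zero submodule is a minimal prime, but there are no vertices.
\<close>

context module
begin

section \<open>Prime submodules of a cyclic module\<close>

lemma cyclic_element:
  assumes "span {x} = UNIV"
  obtains t where "m = t *s x"
  using assms span_singleton[of x] by blast

lemma colon_iff_generator:
  assumes "span {x} = UNIV" "subspace N"
  shows "r \<in> colon N \<longleftrightarrow> r *s x \<in> N"
proof
  assume rx: "r *s x \<in> N"
  have "r *s m \<in> N" for m
  proof -
    obtain t where "m = t *s x" using cyclic_element[OF assms(1)] .
    then have "r *s m = t *s (r *s x)" by (simp add: mult.commute)
    then show ?thesis using rx assms(2) by (simp add: subspace_scale del: scale_scale)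
  qed
  then show "r \<in> colon N" by (simp add: colon_def)
qed (simp add: colon_def)

lemma prime_submodule_generator:
  assumes "span {x} = UNIV" "prime_submodule P"
  shows "x \<notin> P" and "(r * s) *s x \<in> P \<longleftrightarrow> r *s x \<in> P \<or> s *s x \<in> P"
proof -
  have sub: "subspace P" and ne: "P \<noteq> UNIV"
    and pr: "\<And>r e. r *s e \<in> P \<Longrightarrow> r \<in> colon P \<or> e \<in> P"
    using assms(2) by (auto simp: prime_submodule_def)
  show "x \<notin> P"
  proof
    assume "x \<in> P"
    then have "m \<in> P" for m
      using cyclic_element[OF assms(1), of m] sub by (metis subspace_scale)
    then show False using ne by blast
  qed
  show "(r * s) *s x \<in> P \<longleftrightarrow> r *s x \<in> P \<or> s *s x \<in> P"
  proof
    assume "(r * s) *s x \<in> P"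
    then have "r *s (s *s x) \<in> P" by simp
    then show "r *s x \<in> P \<or> s *s x \<in> P"
      using pr colon_iff_generator[OF assms(1) sub] by blast
  next
    assume "r *s x \<in> P \<or> s *s x \<in> P"
    then show "(r * s) *s x \<in> P"
      using sub by (metis mult.commute scale_scale subspace_scale)
  qed
qed

lemma prime_submodule_prod:
  assumes "span {x} = UNIV" "prime_submodule P" "finite A"
  shows "(\<Prod>i\<in>A. f i) *s x \<in> P \<longleftrightarrow> (\<exists>i\<in>A. f i *s x \<in> P)"
  using assms(3)
  by (induction A rule: finite_induct)
     (auto simp: prime_submodule_generator[OF assms(1,2)] simp del: scale_scale)

lemma prime_submodule_power:
  assumes "span {x} = UNIV" "prime_submodule P"
  shows "(a ^ k) *s x \<in> P \<Longrightarrow> a *s x \<in> P"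
  by (induction k)
     (auto simp: prime_submodule_generator[OF assms] simp del: scale_scale)

section \<open>Elements of a minimal prime submodule\<close>

text \<open>
  Krull's lemma for a cyclic module: a submodule maximal among those disjoint from \<open>Sx\<close> is prime,
  because two submodules strictly above it contain \<open>s\<^sub>1 x\<close> and \<open>s\<^sub>2 x\<close>, and a failure of
  primality would then put \<open>s\<^sub>1 s\<^sub>2 x\<close> into it.
\<close>

lemma prime_submodule_avoiding:
  assumes x: "span {x} = UNIV"
    and one: "1 \<in> S" and mult: "\<And>s t. s \<in> S \<Longrightarrow> t \<in> S \<Longrightarrow> s * t \<in> S"
    and nz: "\<And>s. s \<in> S \<Longrightarrow> s *s x \<noteq> 0"
  obtains Q where "prime_submodule Q" "\<And>s. s \<in> S \<Longrightarrow> s *s x \<notin> Q"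
proof -
  define A where "A = {N. subspace N \<and> (\<forall>s\<in>S. s *s x \<notin> N)}"
  have "{0} \<in> A" using nz by (auto simp: A_def)
  then have "A \<noteq> {}" by blast
  moreover have "\<Union>C \<in> A" if "C \<noteq> {}" and ch: "subset.chain A C" for C
  proof -
    have CA: "C \<subseteq> A" using ch by (simp add: subset.chain_def)
    have sub: "subspace W" if "W \<in> C" for W using CA that by (auto simp: A_def)
    have "subspace (\<Union>C)"
    proof (rule subspaceI)
      show "0 \<in> \<Union>C" using that(1) sub subspace_0 by blast
    next
      fix u v assume "u \<in> \<Union>C" "v \<in> \<Union>C"
      then obtain U V where "U \<in> C" "V \<in> C" "u \<in> U" "v \<in> V" by blast
      moreover have "U \<subseteq> V \<or> V \<subseteq> U"
        using ch \<open>U \<in> C\<close> \<open>V \<in> C\<close> by (auto simp: subset.chain_def)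
      ultimately obtain W where "W \<in> C" "u \<in> W" "v \<in> W" by blast
      then show "u + v \<in> \<Union>C" using sub subspace_add by blast
    next
      fix c u assume "u \<in> \<Union>C"
      then show "c *s u \<in> \<Union>C" using sub subspace_scale by blast
    qed
    then show ?thesis using CA by (auto simp: A_def)
  qed
  ultimately obtain Q where QA: "Q \<in> A" and max: "\<And>X. X \<in> A \<Longrightarrow> Q \<subseteq> X \<Longrightarrow> X = Q"
    using subset_Zorn_nonempty[of A] by metis
  have Q: "subspace Q" and av: "\<And>s. s \<in> S \<Longrightarrow> s *s x \<notin> Q" using QA by (auto simp: A_def)
  have meet: "\<exists>s\<in>S. \<exists>q\<in>Q. \<exists>u. s *s x = q + u *s e" if "e \<notin> Q" for e
  proof -
    have "span (insert e Q) \<noteq> Q" using that span_base[of e "insert e Q"] by auto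
    moreover have "Q \<subseteq> span (insert e Q)" using span_superset[of "insert e Q"] by blast
    ultimately have "span (insert e Q) \<notin> A" using max by blast
    then obtain s where s: "s \<in> S" "s *s x \<in> span (insert e Q)"
      by (auto simp: A_def)
    then obtain u where "s *s x - u *s e \<in> span Q" by (auto simp: span_breakdown_eq)
    then have "s *s x - u *s e \<in> Q" using Q by (simp add: span_eq_iff[THEN iffD2])
    then show ?thesis using s(1) by (metis diff_add_cancel)
  qed
  have "r \<in> colon Q \<or> e \<in> Q" if re: "r *s e \<in> Q" for r e
  proof (rule ccontr)
    assume "\<not> (r \<in> colon Q \<or> e \<in> Q)"
    then have rx: "r *s x \<notin> Q" and e: "e \<notin> Q" using colon_iff_generator[OF x Q] by auto
    obtain s1 q1 u where 1: "s1 \<in> S" "q1 \<in> Q" "s1 *s x = q1 + u *s e" using meet[OF e] by blast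
    obtain s2 q2 v where 2: "s2 \<in> S" "q2 \<in> Q" "s2 *s x = q2 + v *s (r *s x)"
      using meet[OF rx] by blast
    have "(s1 * s2) *s x = s1 *s (q2 + v *s (r *s x))" using 2(3) by (metis scale_scale)
    also have "\<dots> = s1 *s q2 + (v * r) *s (s1 *s x)"
      by (simp add: scale_right_distrib ac_simps)
    also have "\<dots> = s1 *s q2 + ((v * r) *s q1 + (v * u) *s (r *s e))"
      unfolding 1(3) by (simp add: scale_right_distrib ac_simps)
    also have "\<dots> \<in> Q" 
      using Q 1(2) 2(2) re by (simp add: subspace_add subspace_scale del: scale_scale)
    finally show False using av[OF mult[OF 1(1) 2(1)]] by simp
  qed
  moreover have "Q \<noteq> UNIV" using av[OF one] by auto
  ultimately have "prime_submodule Q" using Q by (simp add: prime_submodule_def)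
  then show thesis using that av by blast
qed

text \<open>
  If no such \<open>s\<close> and \<open>k\<close> existed, the multiplicative set of all \<open>s a\<^sup>k\<close> with \<open>sx \<notin> P\<close> would be avoided
  by some prime submodule. The exponent \<open>k = 0\<close> forces it inside \<open>P\<close>, hence equal to \<open>P\<close> by
  minimality, while \<open>s = 1\<close>, \<open>k = 1\<close> keeps \<open>ax\<close> out of it.
\<close>

lemma minimal_prime_submodule_annihilator:
  assumes x: "span {x} = UNIV" and P: "minimal_prime_submodule P" and a: "a *s x \<in> P"
  shows "\<exists>s k. s *s x \<notin> P \<and> (s * a ^ k) *s x = 0"
proof (rule ccontr)
  assume neg: "\<not> ?thesis"
  have pP: "prime_submodule P" using P by (simp add: minimal_prime_submodule_def)
  note gen = prime_submodule_generator[OF x pP]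
  define S where "S = {s * a ^ k | s k. s *s x \<notin> P}"
  have SI: "s * a ^ k \<in> S" if "s *s x \<notin> P" for s k unfolding S_def using that by blast
  have one: "1 \<in> S" using SI[of 1 0] gen(1) by simp
  have mult: "u * v \<in> S" if "u \<in> S" "v \<in> S" for u v
  proof -
    obtain s k t l where "u = s * a ^ k" "v = t * a ^ l" "s *s x \<notin> P" "t *s x \<notin> P"
      using \<open>u \<in> S\<close> \<open>v \<in> S\<close> by (auto simp: S_def)
    then have "u * v = (s * t) * a ^ (k + l)" "(s * t) *s x \<notin> P"
      using gen(2) by (simp_all add: power_add ac_simps del: scale_scale)
    then show ?thesis using SI by simp
  qed
  have nz: "s *s x \<noteq> 0" if "s \<in> S" for s
    using neg that unfolding S_def by blast
  obtain Q where Q: "prime_submodule Q" and av: "\<And>s. s \<in> S \<Longrightarrow> s *s x \<notin> Q"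
    using prime_submodule_avoiding[OF x one mult nz] by blast
  have "Q \<subseteq> P"
  proof
    fix m assume "m \<in> Q"
    obtain t where t: "m = t *s x" using cyclic_element[OF x] .
    show "m \<in> P" using SI[of t 0] av[of t] \<open>m \<in> Q\<close> t by auto
  qed
  then have "Q = P" using P Q by (simp add: minimal_prime_submodule_def)
  moreover have "a \<in> S" using SI[of 1 1] gen(1) by simp
  ultimately show False using av[of a] a by simp
qed

section \<open>Cliques of cyclic submodules\<close>

lemma submodule_mult_eq_zero:
  assumes "\<And>r s m. r \<in> colon N \<Longrightarrow> s \<in> colon K \<Longrightarrow> (r * s) *s m = 0"
  shows "submodule_mult N K = {0}"
proof -
  interpret R: module "(*) :: 'a \<Rightarrow> 'a \<Rightarrow> 'a"
    by unfold_locales (simp_all add: algebra_simps)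
  have "c *s m = 0" if "c \<in> ideal_mult (colon N) (colon K)" for c m
  proof -
    have "R.subspace {c. c *s m = 0}"
      by (rule R.subspaceI) (auto simp: scale_left_distrib simp flip: scale_scale)
    moreover have "{r * s | r s. r \<in> colon N \<and> s \<in> colon K} \<subseteq> {c. c *s m = 0}"
      using assms by blast
    ultimately show ?thesis
      using that R.span_minimal unfolding ideal_mult_def by blast
  qed
  then have "{c *s m | c m. c \<in> ideal_mult (colon N) (colon K)} \<subseteq> {0}" by blast
  then have "submodule_mult N K \<subseteq> {0}"
    unfolding submodule_mult_def ideal_smult_def by (simp add: span_minimal)
  then show ?thesis unfolding submodule_mult_def ideal_smult_def using span_zero by blast
qed

lemma submodule_mult_span_singletons:
  assumes x: "span {x} = UNIV" and bc: "(b * c) *s x = 0"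
  shows "submodule_mult (span {b *s x}) (span {c *s x}) = {0}"
proof (rule submodule_mult_eq_zero)
  fix r s m
  assume "r \<in> colon (span {b *s x})" "s \<in> colon (span {c *s x})"
  then have "r *s x \<in> span {b *s x}" "s *s x \<in> span {c *s x}" by (auto simp: colon_def)
  then obtain u v where u: "r *s x = u *s (b *s x)" and v: "s *s x = v *s (c *s x)"
    by (auto simp: span_singleton)
  obtain t where t: "m = t *s x" using cyclic_element[OF x] .
  have "(r * s) *s m = (t * r) *s (s *s x)" by (simp add: t ac_simps)
  also have "\<dots> = (t * v * c) *s (r *s x)" unfolding v by (simp add: ac_simps)
  also have "\<dots> = (t * v * u) *s ((b * c) *s x)" unfolding u by (simp add: ac_simps)
  finally show "(r * s) *s m = 0" using bc by simp
qed

text \<open>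
  Elements that lie in all members of \<open>\<P>\<close> but one separate their cyclic submodules, and also keep
  them proper as soon as \<open>\<P>\<close> has a second member.
\<close>

lemma AG_clique_of_separating_elements:
  assumes x: "span {x} = UNIV"
    and sub: "\<And>P. P \<in> \<P> \<Longrightarrow> subspace P"
    and notin: "\<And>P. P \<in> \<P> \<Longrightarrow> b P *s x \<notin> P"
    and other: "\<And>P Q. P \<in> \<P> \<Longrightarrow> Q \<in> \<P> \<Longrightarrow> P \<noteq> Q \<Longrightarrow> b P *s x \<in> Q"
    and zero: "\<And>P Q. P \<in> \<P> \<Longrightarrow> Q \<in> \<P> \<Longrightarrow> P \<noteq> Q \<Longrightarrow> (b P * b Q) *s x = 0"
    and two: "\<And>P. P \<in> \<P> \<Longrightarrow> \<exists>Q\<in>\<P>. Q \<noteq> P"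
  shows "inj_on (\<lambda>P. span {b P *s x}) \<P>" and "AG_clique ((\<lambda>P. span {b P *s x}) ` \<P>)"
proof -
  define N where "N = (\<lambda>P. span {b P *s x})"
  have gen: "b P *s x \<in> N P" for P unfolding N_def by (rule span_base) simp
  have le: "N P \<subseteq> Q" if "P \<in> \<P>" "Q \<in> \<P>" "P \<noteq> Q" for P Q
    unfolding N_def using other[OF that] sub[OF that(2)] by (intro span_minimal) auto
  have neq: "N P \<noteq> N Q" if "P \<in> \<P>" "Q \<in> \<P>" "P \<noteq> Q" for P Q
    using le[of Q P] that gen[of P] notin[of P] by auto
  have nz: "N P \<noteq> {0}" if "P \<in> \<P>" for P
    using gen[of P] notin[OF that] subspace_0[OF sub[OF that]] by auto
  have prod0: "submodule_mult (N P) (N Q) = {0}" if "P \<in> \<P>" "Q \<in> \<P>" "P \<noteq> Q" for P Q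
    unfolding N_def by (rule submodule_mult_span_singletons[OF x zero[OF that]])
  have vert: "N P \<in> AG_verts" if P: "P \<in> \<P>" for P
  proof -
    obtain Q where Q: "Q \<in> \<P>" "Q \<noteq> P" using two[OF P] by blast
    have "N Q \<noteq> UNIV" using le[OF Q(1) P Q(2)] notin[OF P] by auto
    moreover have "submodule_mult (N P) (N Q) = {0}" using prod0[OF P Q(1)] Q(2) by auto
    moreover have "subspace (N P)" "subspace (N Q)" by (simp_all add: N_def)
    ultimately show ?thesis
      using nz[OF P] nz[OF Q(1)] unfolding AG_verts_def by (intro CollectI conjI exI[of _ "N Q"])
  qed
  show "inj_on (\<lambda>P. span {b P *s x}) \<P>" using neq unfolding N_def inj_on_def by blast
  have "AG_clique (N ` \<P>)" using vert prod0 unfolding AG_clique_def AG_adj_def by blast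
  then show "AG_clique ((\<lambda>P. span {b P *s x}) ` \<P>)" by (simp add: N_def)
qed

section \<open>Separating finitely many minimal primes\<close>

text \<open>
  Products of elements that separate two primes at a time satisfy the first two conclusions. For the
  third, a high power of each product is multiplied by annihilators: the one for the ordered pair
  \<open>(P, Q)\<close> goes into \<open>b P\<close> only, since it is known to avoid \<open>P\<close> but not to avoid \<open>Q\<close>.
\<close>

lemma minimal_primes_separating_elements:
  assumes x: "span {x} = UNIV" and fin: "finite \<P>"
    and min: "\<And>P. P \<in> \<P> \<Longrightarrow> minimal_prime_submodule P"
  obtains b where
    "\<And>P. P \<in> \<P> \<Longrightarrow> b P *s x \<notin> P"
    "\<And>P Q. P \<in> \<P> \<Longrightarrow> Q \<in> \<P> \<Longrightarrow> P \<noteq> Q \<Longrightarrow> b P *s x \<in> Q"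
    "\<And>P Q. P \<in> \<P> \<Longrightarrow> Q \<in> \<P> \<Longrightarrow> P \<noteq> Q \<Longrightarrow> (b P * b Q) *s x = 0"
proof -
  have prime: "prime_submodule P" if "P \<in> \<P>" for P
    using min[OF that] by (simp add: minimal_prime_submodule_def)
  note gen = prime_submodule_generator(2)[OF x prime]
  note prod = prime_submodule_prod[OF x prime]
  have "\<exists>c. c *s x \<in> Q \<and> c *s x \<notin> P" if "P \<in> \<P>" "Q \<in> \<P>" "P \<noteq> Q" for P Q
  proof -
    have "\<not> Q \<subseteq> P"
      using min[OF that(1)] prime[OF that(2)] that(3) by (auto simp: minimal_prime_submodule_def)
    then obtain m where "m \<in> Q" "m \<notin> P" by blast
    then show ?thesis using cyclic_element[OF x, of m] by metis
  qed
  then obtain c where c: "\<And>P Q. P \<in> \<P> \<Longrightarrow> Q \<in> \<P> \<Longrightarrow> P \<noteq> Q \<Longrightarrow> c P Q *s x \<in> Q \<and> c P Q *s x \<notin> P"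
    by metis
  define a where "a P = (\<Prod>Q\<in>\<P> - {P}. c P Q)" for P
  have a_notin: "a P *s x \<notin> P" if "P \<in> \<P>" for P
    using c that fin by (auto simp: a_def prod)
  have a_in: "a P *s x \<in> Q" if "P \<in> \<P>" "Q \<in> \<P>" "P \<noteq> Q" for P Q
    using c that fin by (auto simp: a_def prod)
  have "\<exists>s k. s *s x \<notin> P \<and> (s * (a P * a Q) ^ k) *s x = 0"
    if "P \<in> \<P>" "Q \<in> \<P>" "P \<noteq> Q" for P Q
  proof -
    have "(a P * a Q) *s x \<in> P" using gen[OF that(1)] a_in[of Q P] that by blast
    then show ?thesis by (rule minimal_prime_submodule_annihilator[OF x min[OF that(1)]])
  qed
  then obtain s k where
    s: "\<And>P Q. P \<in> \<P> \<Longrightarrow> Q \<in> \<P> \<Longrightarrow> P \<noteq> Q \<Longrightarrow> s P Q *s x \<notin> P" and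
    k: "\<And>P Q. P \<in> \<P> \<Longrightarrow> Q \<in> \<P> \<Longrightarrow> P \<noteq> Q \<Longrightarrow> (s P Q * (a P * a Q) ^ k P Q) *s x = 0"
    by metis
  \<comment> \<open>One exponent for all pairs, positive so that \<open>b P\<close> stays a multiple of \<open>a P\<close>.\<close>
  define l where "l = Suc (\<Sum>P\<in>\<P>. \<Sum>Q\<in>\<P>. k P Q)"
  have kl: "k P Q \<le> l" if "P \<in> \<P>" "Q \<in> \<P>" for P Q
  proof -
    have "k P Q \<le> (\<Sum>Q\<in>\<P>. k P Q)" using fin that by (intro member_le_sum) auto
    also have "\<dots> \<le> (\<Sum>P\<in>\<P>. \<Sum>Q\<in>\<P>. k P Q)"
      using member_le_sum[of P \<P> "\<lambda>P. \<Sum>Q\<in>\<P>. k P Q"] fin that by simp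
    finally show ?thesis by (simp add: l_def)
  qed
  define b where "b P = a P ^ l * (\<Prod>Q\<in>\<P> - {P}. s P Q)" for P
  have b_notin: "b P *s x \<notin> P" if P: "P \<in> \<P>" for P
  proof -
    have "(a P ^ l) *s x \<notin> P" using prime_submodule_power[OF x prime[OF P]] a_notin[OF P] by blast
    moreover have "(\<Prod>Q\<in>\<P> - {P}. s P Q) *s x \<notin> P" using s P fin by (auto simp: prod)
    ultimately show ?thesis using gen[OF P] unfolding b_def by blast
  qed
  have b_in: "b P *s x \<in> Q" if "P \<in> \<P>" "Q \<in> \<P>" "P \<noteq> Q" for P Q
  proof -
    have "b P = a P * (a P ^ (l - 1) * (\<Prod>Q\<in>\<P> - {P}. s P Q))"
      by (simp add: b_def l_def ac_simps)
    then show ?thesis using gen[OF that(2)] a_in[OF that] by metis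
  qed
  have b_zero: "(b P * b Q) *s x = 0" if PQ: "P \<in> \<P>" "Q \<in> \<P>" "P \<noteq> Q" for P Q
  proof -
    define z where "z = s P Q * (a P * a Q) ^ k P Q"
    have "s P Q dvd (\<Prod>Q\<in>\<P> - {P}. s P Q)" using fin PQ by (intro dvd_prodI) auto
    moreover have "(a P * a Q) ^ k P Q dvd (a P * a Q) ^ l" using kl PQ by (intro le_imp_power_dvd)
    ultimately have "z dvd (\<Prod>Q\<in>\<P> - {P}. s P Q) * (a P * a Q) ^ l"
      unfolding z_def by (rule mult_dvd_mono)
    also have "\<dots> dvd b P * b Q"
      by (rule dvdI[of _ _ "\<Prod>R\<in>\<P> - {Q}. s Q R"]) (simp add: b_def power_mult_distrib ac_simps)
    finally obtain w where "b P * b Q = w * z" by (metis dvd_def mult.commute)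
    then have "(b P * b Q) *s x = w *s (z *s x)" by simp
    then show ?thesis using k[OF PQ] by (simp add: z_def)
  qed
  show thesis using that[of b, OF b_notin b_in b_zero] by this
qed

lemma minimal_primes_clique:
  assumes "cyclic_module" "AG_verts \<noteq> {}" "finite \<P>"
    and min: "\<And>P. P \<in> \<P> \<Longrightarrow> minimal_prime_submodule P"
  shows "\<exists>C. finite C \<and> card C = card \<P> \<and> AG_clique C"
proof (cases "\<exists>P\<in>\<P>. \<exists>Q\<in>\<P>. Q \<noteq> P")
  case True
  obtain x where x: "span {x} = UNIV" using assms(1) by (auto simp: cyclic_module_def)
  obtain b where b:
    "\<And>P. P \<in> \<P> \<Longrightarrow> b P *s x \<notin> P"
    "\<And>P Q. P \<in> \<P> \<Longrightarrow> Q \<in> \<P> \<Longrightarrow> P \<noteq> Q \<Longrightarrow> b P *s x \<in> Q"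
    "\<And>P Q. P \<in> \<P> \<Longrightarrow> Q \<in> \<P> \<Longrightarrow> P \<noteq> Q \<Longrightarrow> (b P * b Q) *s x = 0"
    using minimal_primes_separating_elements[OF x assms(3) min] by blast
  have sub: "subspace P" if "P \<in> \<P>" for P
    using min[OF that] by (simp add: minimal_prime_submodule_def prime_submodule_def)
  have two: "\<exists>Q\<in>\<P>. Q \<noteq> P" if "P \<in> \<P>" for P using True by metis
  note C = AG_clique_of_separating_elements[OF x sub b two]
  show ?thesis
    using C(2) card_image[OF C(1)] assms(3) by (intro exI conjI) auto
next
  case False
  show ?thesis
  proof (cases "\<P> = {}")
    case True
    then show ?thesis by (intro exI[of _ "{}"]) (simp add: AG_clique_def)
  next
    case nonempty: False
    obtain v where "v \<in> AG_verts" using assms(2) by blast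
    moreover obtain P where "\<P> = {P}" using False nonempty by blast
    ultimately show ?thesis by (intro exI[of _ "{v}"]) (simp add: AG_clique_def)
  qed
qed

end

theorem theorem2p18:
  fixes scale :: "'r::comm_ring_1 \<Rightarrow> 'm::ab_group_add \<Rightarrow> 'm"
    and \<P> :: "'m set set"
    and n :: nat
  assumes "module scale"
    and "module.cyclic_module scale"
    and "module.AG_verts scale \<noteq> {}"
    and "finite \<P>" and "card \<P> = n"
    and "\<And>P. P \<in> \<P> \<Longrightarrow> module.minimal_prime_submodule scale P"
  shows "\<exists>C. finite C \<and> card C = n \<and> module.AG_clique scale C"
  using module.minimal_primes_clique[OF assms(1-4,6)] assms(5) by simp

end
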